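(* Suppose that every finite simple graph that contains no triangle, no ISK4 and no $K_{3,3}$ (as induced subgraphs) has a vertex of degree at most $2$. Then every finite simple graph that contains no triangle and no ISK4 is $3$-colorable.
   Context: $G$ contains $H$ if $H$ is isomorphic to an induced subgraph of $G$. A subdivision of a graph is obtained by repeatedly replacing an edge $vw$ by a path $vuw$ through a new vertex $u$. An ISK4 of $G$ is an induced subgraph of $G$ that is a subdivision of $K_4$. $K_{3,3}$ is the complete bipartite graph with both sides of size 3. *)

theory Defs
  imports "Graph_Theory.Graph_Theory"
begin

text \<open>
  A finite simple graph is a \<^const>\<open>pair_graph\<close>: a finite, loop-free, symmetric digraph whose arcs
  are pairs of vertices, an edge being a pair of opposite arcs.  The null graph is allowed.
\<close>

text \<open>
  The predicates for complete and complete bipartite graphs are closed under isomorphism, so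
  ``\<open>G\<close> contains \<open>K\<^bsub>3,3\<^esub>\<close>'' means that some induced subgraph of \<open>G\<close> satisfies the predicate.
\<close>

definition contains_triangle :: "'a pair_pre_digraph \<Rightarrow> bool" where
  "contains_triangle G \<longleftrightarrow>
     (\<exists>H :: 'a pair_pre_digraph. induced_subgraph (with_proj H) (with_proj G) \<and> K\<^bsub>3\<^esub> (with_proj H))"

definition contains_K33 :: "'a pair_pre_digraph \<Rightarrow> bool" where
  "contains_K33 G \<longleftrightarrow>
     (\<exists>H :: 'a pair_pre_digraph. induced_subgraph (with_proj H) (with_proj G) \<and> K\<^bsub>3,3\<^esub> (with_proj H))"

text \<open>
  A subdivision keeps the vertices of the graph it starts from, so the \<open>K\<^sub>4\<close> that is subdivided
  can be taken on the vertex type of \<open>H\<close>.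
\<close>

definition ISK4_of :: "'a pair_pre_digraph \<Rightarrow> 'a pair_pre_digraph \<Rightarrow> bool" where
  "ISK4_of H G \<longleftrightarrow> induced_subgraph (with_proj H) (with_proj G) \<and>
     (\<exists>K :: 'a pair_pre_digraph. K\<^bsub>4\<^esub> (with_proj K) \<and> subdivision_pair K H)"

definition contains_ISK4 :: "'a pair_pre_digraph \<Rightarrow> bool" where
  "contains_ISK4 G \<longleftrightarrow> (\<exists>H. ISK4_of H G)"

text \<open>Every edge at \<open>v\<close> gives exactly one arc leaving \<open>v\<close>.\<close>

definition degree :: "'a pair_pre_digraph \<Rightarrow> 'a \<Rightarrow> nat" where
  "degree G v = out_degree (with_proj G) v"

definition colorable :: "nat \<Rightarrow> 'a pair_pre_digraph \<Rightarrow> bool" where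
  "colorable k G \<longleftrightarrow>
     (\<exists>c :: 'a \<Rightarrow> nat. (\<forall>v \<in> pverts G. c v < k) \<and> (\<forall>(u, v) \<in> parcs G. c u \<noteq> c v))"

end

theory Submission
  imports Defs
begin

text \<open>
  Induct on the number of vertices.  A graph without \<open>K\<^bsub>3,3\<^esub>\<close> has a vertex of degree at most 2, and
  a 3-colouring of the rest extends to it.  Otherwise take a maximal complete bipartite
  subgraph with sides \<open>A\<close>, \<open>B\<close> of size at least 3; triangle-freeness makes it induced.  If two
  distinct vertices \<open>x\<close>, \<open>y\<close> of one side, say \<open>A\<close>, were joined by a path through vertices outside
  \<open>A \<union> B\<close>, then a shortest such path, together with \<open>x\<close>, \<open>y\<close>, a third vertex of \<open>A\<close> and two
  vertices of \<open>B\<close> that have no neighbour on it, would induce a subdivision of \<open>K\<^sub>4\<close>.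
  Hence every component of the graph outside \<open>A \<union> B\<close> attaches to at most one vertex of
  each side, that is, to a clique, and 3-colourings of the two sides of this clique cutset can be
  matched by permuting colours.
\<close>

subsection \<open>Induced subgraphs\<close>

text \<open>Replaces the locale by plain conditions on sets and relations. Finiteness of the arc set
  comes from that of the vertex set.\<close>

lemma pair_graph_iff:
  "pair_graph G \<longleftrightarrow> finite (pverts G) \<and> parcs G \<subseteq> pverts G \<times> pverts G \<and> sym (parcs G) \<and> irrefl (parcs G)"
proof
  assume "pair_graph G"
  then interpret pair_graph G .
  show "finite (pverts G) \<and> parcs G \<subseteq> pverts G \<times> pverts G \<and> sym (parcs G) \<and> irrefl (parcs G)"
    using pair_finite_verts wellformed' arcs_symmetric no_loops'
    unfolding irrefl_def sym_def by (intro conjI subrelI) blast+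
next
  assume *: "finite (pverts G) \<and> parcs G \<subseteq> pverts G \<times> pverts G \<and> sym (parcs G) \<and> irrefl (parcs G)"
  then have "finite (parcs G)" by (meson finite_SigmaI finite_subset)
  with * show "pair_graph G"
    by unfold_locales (auto simp: symmetric_def irrefl_def)
qed

lemma induced_subgraph_pair_iff:
  assumes "pair_graph G"
  shows "induced_subgraph (with_proj H) (with_proj G) \<longleftrightarrow>
    pverts H \<subseteq> pverts G \<and> parcs H = parcs G \<inter> pverts H \<times> pverts H"
proof -
  interpret pair_graph G by fact
  have "wf_digraph (with_proj H)" if "parcs H \<subseteq> pverts H \<times> pverts H"
    unfolding wf_digraph_wp_iff using that by unfold_locales auto
  moreover have "wf_digraph (with_proj G)" by (simp add: wf_digraph_axioms)
  ultimately show ?thesis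
    by (fastforce simp: induced_subgraph_def subgraph_def)
qed

definition induced :: "'a pair_pre_digraph \<Rightarrow> 'a set \<Rightarrow> 'a pair_pre_digraph" where
  "induced G S = \<lparr>pverts = S, parcs = parcs G \<inter> S \<times> S\<rparr>"

lemma induced_simps [simp]: "pverts (induced G S) = S" "parcs (induced G S) = parcs G \<inter> S \<times> S"
  by (simp_all add: induced_def)

lemma pair_graph_induced:
  assumes "pair_graph G" "S \<subseteq> pverts G"
  shows "pair_graph (induced G S)"
  using assms by (auto simp: pair_graph_iff irrefl_def finite_subset sym_def)

lemma induced_subgraph_trans:
  assumes "pair_graph G" "S \<subseteq> pverts G"
    and "induced_subgraph (with_proj H) (with_proj (induced G S))"
  shows "induced_subgraph (with_proj H) (with_proj G)"
  using assms(2,3) unfolding induced_subgraph_pair_iff[OF assms(1)]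
    induced_subgraph_pair_iff[OF pair_graph_induced[OF assms(1,2)]] by auto

lemma contains_triangle_induced:
  assumes "pair_graph G" "S \<subseteq> pverts G" "contains_triangle (induced G S)"
  shows "contains_triangle G"
  using assms induced_subgraph_trans unfolding contains_triangle_def by blast

lemma contains_ISK4_induced:
  assumes "pair_graph G" "S \<subseteq> pverts G" "contains_ISK4 (induced G S)"
  shows "contains_ISK4 G"
  using assms induced_subgraph_trans unfolding contains_ISK4_def ISK4_of_def by blast

lemma contains_triangleI:
  assumes G: "pair_graph G" and E: "(a, b) \<in> parcs G" "(b, c) \<in> parcs G" "(a, c) \<in> parcs G"
  shows "contains_triangle G"
proof -
  have *: "parcs G \<subseteq> pverts G \<times> pverts G" "sym (parcs G)" "irrefl (parcs G)"
    using G by (auto simp: pair_graph_iff)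
  have d: "a \<noteq> b" "b \<noteq> c" "a \<noteq> c" using * E by (auto simp: irrefl_def)
  have rev: "(b, a) \<in> parcs G" "(c, b) \<in> parcs G" "(c, a) \<in> parcs G" 
    using * E by (auto dest: symD)
  let ?H = "induced G {a, b, c}"
  have "induced_subgraph (with_proj ?H) (with_proj G)"
    unfolding induced_subgraph_pair_iff[OF G] using * E by auto
  moreover have "K\<^bsub>3\<^esub> (with_proj ?H)"
    unfolding complete_digraph_pair_def using d E rev * by (auto simp: irrefl_def)
  ultimately show ?thesis unfolding contains_triangle_def by blast
qed

subsection \<open>Colouring\<close>

text \<open>The images \<open>f\<close> K\<open>and\<close>g \<open>K\<close> have equal size, so
  their complements in the finite set \<open>X\<close> do too, and any bijection of the complements
  completes the partial one. With \<open>X\<close> the set of colours, this gives a colour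
  permutation.\<close>

lemma extend_bij_betw:
  assumes "finite X" "inj_on f K" "inj_on g K" "f ` K \<subseteq> X" "g ` K \<subseteq> X"
  obtains p where "bij_betw p X X" "\<And>k. k \<in> K \<Longrightarrow> p (f k) = g k"
proof -
  have "card (f ` K) = card (g ` K)"
    using assms by (simp add: card_image)
  then have "card (X - f ` K) = card (X - g ` K)"
    using assms by (simp add: card_Diff_subset finite_subset)
  then obtain q where q: "bij_betw q (X - f ` K) (X - g ` K)"
    using assms(1) by (meson finite_Diff finite_same_card_bij)
  let ?p = "\<lambda>x. if x \<in> f ` K then g (inv_into K f x) else q x"
  have "bij_betw (g \<circ> inv_into K f) (f ` K) (g ` K)"
    using assms by (intro bij_betw_trans[OF bij_betw_inv_into]) (auto simp: bij_betw_def)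
  then have "bij_betw ?p (f ` K) (g ` K)"
    by (rule bij_betw_cong[THEN iffD1, rotated]) auto
  moreover have "bij_betw ?p (X - f ` K) (X - g ` K)"
    using q by (rule bij_betw_cong[THEN iffD1, rotated]) auto
  ultimately have "bij_betw ?p (f ` K \<union> (X - f ` K)) (g ` K \<union> (X - g ` K))"
    by (rule bij_betw_combine) auto
  then have "bij_betw ?p X X"
    using assms(4,5) by (simp add: Un_absorb1)
  moreover have "?p (f k) = g k" if "k \<in> K" for k
    using that assms(2) by auto
  ultimately show thesis by (rule that)
qed

lemma colorable_induced_iff:
  "colorable k (induced G S) \<longleftrightarrow>
    (\<exists>c. (\<forall>v\<in>S. c v < k) \<and> (\<forall>u\<in>S. \<forall>v\<in>S. (u, v) \<in> parcs G \<longrightarrow> c u \<noteq> c v))"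
  unfolding colorable_def by (intro iff_exI conj_cong) auto

text \<open>Both colourings are injective on the clique \<open>S \<inter> T\<close>, so permuting
  the colours on \<open>T\<close> makes them agree there. No arc joins \<open>S - T\<close> to
  \<open>T - S\<close>, so the glued colouring is proper.\<close>

lemma colorable_clique_cutset:
  assumes G: "pair_graph G"
    and V: "pverts G = S \<union> T"
    and clique: "\<And>x y. \<lbrakk>x \<in> S \<inter> T; y \<in> S \<inter> T; x \<noteq> y\<rbrakk> \<Longrightarrow> (x, y) \<in> parcs G"
    and cut: "\<And>x y. \<lbrakk>x \<in> S - T; y \<in> T - S\<rbrakk> \<Longrightarrow> (x, y) \<notin> parcs G"
    and S: "colorable k (induced G S)" and T: "colorable k (induced G T)"
  shows "colorable k G"
proof -
  have *: "parcs G \<subseteq> pverts G \<times> pverts G" "sym (parcs G)"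
    using G by (auto simp: pair_graph_iff)
  obtain c where c: "\<forall>v\<in>S. c v < k" "\<forall>u\<in>S. \<forall>v\<in>S. (u, v) \<in> parcs G \<longrightarrow> c u \<noteq> c v"
    using S unfolding colorable_induced_iff by blast
  obtain d where d: "\<forall>v\<in>T. d v < k" "\<forall>u\<in>T. \<forall>v\<in>T. (u, v) \<in> parcs G \<longrightarrow> d u \<noteq> d v"
    using T unfolding colorable_induced_iff by blast
  have "inj_on d (S \<inter> T)" "inj_on c (S \<inter> T)"
    using c(2) d(2) clique by (meson IntD1 IntD2 inj_onI)+
  then obtain p where p: "bij_betw p {..<k} {..<k}" "\<And>x. x \<in> S \<inter> T \<Longrightarrow> p (d x) = c x"
    by (rule extend_bij_betw[OF finite_lessThan[of k]]) (use c(1) d(1) in auto)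
  let ?c = "\<lambda>x. if x \<in> S then c x else p (d x)"
  have cT: "?c x = p (d x)" if "x \<in> T" for x
    using that p(2) by auto
  have "?c x < k" if "x \<in> pverts G" for x
    using that V c(1) d(1) p(1) by (auto simp: bij_betw_def)
  moreover have "?c x \<noteq> ?c y" if xy: "(x, y) \<in> parcs G" for x y
  proof -
    \<comment> \<open>\<open>cut\<close> is applied in both directions, the arcs being symmetric, so
      every arc lies within one of the two parts.\<close>
    have "x \<in> S \<and> y \<in> S \<or> x \<in> T \<and> y \<in> T"
      using xy * V cut[of x y] cut[of y x] by (auto dest: symD)
    then show ?thesis
    proof
      assume "x \<in> S \<and> y \<in> S" then show ?thesis using c(2) xy by auto
    next
      assume xyT: "x \<in> T \<and> y \<in> T"
      then have "d x \<noteq> d y" "d x \<in> {..<k}" "d y \<in> {..<k}" using d xy by auto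
      then have "p (d x) \<noteq> p (d y)" using p(1) by (metis bij_betw_def inj_on_def)
      then show ?thesis using cT xyT by presburger
    qed
  qed
  ultimately show ?thesis unfolding colorable_def by (intro exI[of _ ?c]) blast
qed

text \<open>Greedy extension: the neighbours of \<open>v\<close> use fewer than \<open>k\<close>
  colours, so some colour is left for \<open>v\<close>.\<close>

lemma colorable_remove_vertex:
  assumes G: "pair_graph G" and v: "v \<in> pverts G" "degree G v < k"
    and col: "colorable k (induced G (pverts G - {v}))"
  shows "colorable k G"
proof -
  have *: "parcs G \<subseteq> pverts G \<times> pverts G" "sym (parcs G)" "irrefl (parcs G)" "finite (pverts G)"
    using G by (auto simp: pair_graph_iff)
  obtain c where c: "\<forall>u\<in>pverts G - {v}. c u < k"
    "\<And>u w. (u, w) \<in> parcs G \<Longrightarrow> u \<noteq> v \<Longrightarrow> w \<noteq> v \<Longrightarrow> c u \<noteq> c w"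
    using col *(1) unfolding colorable_induced_iff by blast
  let ?N = "snd ` out_arcs (with_proj G) v"
  have "finite (out_arcs (with_proj G) v)"
    using *(1,4) by (auto simp: out_arcs_def intro: finite_subset[of _ "pverts G \<times> pverts G"])
  then have "card (c ` ?N) < k" "finite (c ` ?N)"
    using v(2) unfolding degree_def out_degree_def
    by (meson card_image_le finite_imageI le_less_trans)+
  then have "\<not> {..<k} \<subseteq> c ` ?N"
    by (metis card_lessThan card_mono not_less)
  then obtain j where j: "j < k" "j \<notin> c ` ?N" by auto
  have N: "c u \<noteq> j" if "(v, u) \<in> parcs G" for u
    using j(2) that by (force simp: image_iff)
  have "(c(v := j)) x \<noteq> (c(v := j)) y" if "(x, y) \<in> parcs G" for x y
    using that c(2)[of x y] N[of x] N[of y] *(2,3) by (auto simp: irrefl_def dest: symD)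
  moreover have "\<forall>x\<in>pverts G. (c(v := j)) x < k" using c(1) j(1) by auto
  ultimately show ?thesis unfolding colorable_def by blast
qed

subsection \<open>Relabelling\<close>

text \<open>Relabelling bridges the types of the theorem: the degree hypothesis concerns graphs on
  \<open>nat\<close>, the conclusion graphs on an arbitrary type.\<close>

definition map_graph :: "('a \<Rightarrow> 'b) \<Rightarrow> 'a pair_pre_digraph \<Rightarrow> 'b pair_pre_digraph" where
  "map_graph f G = \<lparr>pverts = f ` pverts G, parcs = map_prod f f ` parcs G\<rparr>"

lemma map_graph_simps [simp]:
  "pverts (map_graph f G) = f ` pverts G" "parcs (map_graph f G) = map_prod f f ` parcs G"
  by (simp_all add: map_graph_def)

lemma map_graph_inverse:
  assumes "parcs G \<subseteq> pverts G \<times> pverts G" "\<And>x. x \<in> pverts G \<Longrightarrow> g (f x) = x"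
  shows "map_graph g (map_graph f G) = G"
proof -
  have "(\<lambda>x. map_prod g g (map_prod f f x)) ` parcs G = (\<lambda>x. x) ` parcs G"
    using assms by (intro image_cong) auto
  moreover have "(\<lambda>x. g (f x)) ` pverts G = (\<lambda>x. x) ` pverts G"
    using assms by (intro image_cong) auto
  ultimately show ?thesis by (simp add: map_graph_def image_image)
qed

lemma pair_graph_map_graph:
  assumes "pair_graph G" "inj_on f (pverts G)"
  shows "pair_graph (map_graph f G)"
proof -
  have *: "parcs G \<subseteq> pverts G \<times> pverts G" "sym (parcs G)" "irrefl (parcs G)" "finite (pverts G)"
    using assms by (auto simp: pair_graph_iff)
  have "sym (map_prod f f ` parcs G)"
    using *(2) by (auto intro!: symI dest: symD)
  moreover have "irrefl (map_prod f f ` parcs G)"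
    unfolding irrefl_def
  proof (rule allI, rule notI)
    fix z assume "(z, z) \<in> map_prod f f ` parcs G"
    then obtain x y where "(x, y) \<in> parcs G" "f x = f y" by auto
    with * assms(2) show False by (auto simp: irrefl_def dest: inj_onD)
  qed
  ultimately show ?thesis using * by (auto simp: pair_graph_iff)
qed

lemma induced_subgraph_map_graph:
  assumes "pair_graph G" "inj_on f (pverts G)" "induced_subgraph (with_proj H) (with_proj G)"
  shows "induced_subgraph (with_proj (map_graph f H)) (with_proj (map_graph f G))"
proof -
  have *: "parcs G \<subseteq> pverts G \<times> pverts G" 
    using assms by (auto simp: pair_graph_iff)
  have H: "pverts H \<subseteq> pverts G" "parcs H = parcs G \<inter> pverts H \<times> pverts H"
    using assms by (auto simp: induced_subgraph_pair_iff)
  have "map_prod f f ` parcs H = map_prod f f ` parcs G \<inter> map_prod f f ` (pverts H \<times> pverts H)"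
    using inj_on_image_Int[OF map_prod_inj_on[OF assms(2,2)] *, of "pverts H \<times> pverts H"] H
    by (metis Sigma_mono)
  then show ?thesis
    unfolding induced_subgraph_pair_iff[OF pair_graph_map_graph[OF assms(1,2)]]
    using H(1) by (auto simp: map_prod_surj_on)
qed

lemma complete_map_graph:
  assumes "K\<^bsub>n\<^esub> (with_proj G)" "inj_on f (pverts G)"
  shows "K\<^bsub>n\<^esub> (with_proj (map_graph f G))"
proof -
  have G: "finite (pverts G)" "card (pverts G) = n"
    "parcs G = {(u,v). (u,v) \<in> (pverts G \<times> pverts G) \<and> u \<noteq> v}"
    using assms(1) unfolding complete_digraph_pair_def by auto
  have "map_prod f f ` parcs G = {(u,v). (u,v) \<in> (f ` pverts G \<times> f ` pverts G) \<and> u \<noteq> v}"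
    using assms(2) by (subst G(3)) (force simp: inj_on_def)
  then show ?thesis using G assms(2) unfolding complete_digraph_pair_def
    by (simp add: card_image)
qed

text \<open>Each subdivision step is mirrored in the image. Injectivity is required on the final
  graph \<open>H\<close>, because every new vertex must have a new image.\<close>

lemma subdivision_pair_map_graph:
  assumes "subdivision_pair G H" "inj_on f (pverts H)"
  shows "subdivision_pair (map_graph f G) (map_graph f H)"
  using assms
proof (induction rule: subdivision_pair_induct)
  case base
  then interpret pair_bidirected_digraph G by simp
  have "pair_bidirected_digraph (map_graph f G)"
  proof
    show "symmetric (with_proj (map_graph f G))"
      using pair_sym_arcs by (force simp: symmetric_def sym_def)
  next
    fix e assume "e \<in> parcs (map_graph f G)"
    then obtain u v where "(u, v) \<in> parcs G" "e = (f u, f v)" by auto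
    then show "fst e \<noteq> snd e"
      using base.prems no_loops'[of u v] wellformed'[of u v] by (simp add: inj_on_eq_iff)
  qed (auto dest: wellformed')
  then show ?case by (rule subdivision_pair_base)
next
  case (divide e w H)
  interpret H: pair_bidirected_digraph H
    using divide(3) by (rule bidirected_digraphI_subdivision)
  obtain u v where e: "e = (u, v)" by (cases e)
  have inj: "inj_on f (insert w (pverts H))" using divide.prems by simp
  have uv: "u \<in> pverts H" "v \<in> pverts H" using H.wellformed'[of u v] divide(1) e by auto
  \<comment> \<open>Injectivity lets the image commute with the removal of the subdivided
    edge.\<close>
  have "map_prod f f ` (parcs H - {(u, v), (v, u)}) =
      map_prod f f ` parcs H - map_prod f f ` {(u, v), (v, u)}"
    using uv inj
    by (intro inj_on_image_set_diff[of _ "pverts H \<times> pverts H"] map_prod_inj_on)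
      (auto intro: inj_on_subset dest: H.wellformed')
  then have eq: "map_graph f (subdivide H e w) = subdivide (map_graph f H) (f u, f v) (f w)"
    by (simp add: map_graph_def e subdivide.simps image_Un)
  have "(f u, f v) \<in> parcs (map_graph f H)" using divide(1) e by force
  moreover have "f w \<notin> pverts (map_graph f H)" using inj divide(2) by auto
  moreover have "subdivision_pair (map_graph f G) (map_graph f H)"
    using divide.IH inj by (auto intro: inj_on_subset)
  ultimately show ?case unfolding eq by (rule subdivision_pair_divide)
qed

lemma subdivision_pair_pverts_subset:
  "subdivision_pair G H \<Longrightarrow> pverts G \<subseteq> pverts H"
  using subdivision_verts_subset by fastforce

lemma contains_triangle_map_graph:
  assumes "pair_graph G" "inj_on f (pverts G)" "contains_triangle G"
  shows "contains_triangle (map_graph f G)"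
proof -
  obtain H where H: "induced_subgraph (with_proj H) (with_proj G)" "K\<^bsub>3\<^esub> (with_proj H)"
    using assms(3) unfolding contains_triangle_def by blast
  then have "inj_on f (pverts H)"
    using assms(1,2) by (auto simp: induced_subgraph_pair_iff intro: inj_on_subset)
  then show ?thesis unfolding contains_triangle_def
    using induced_subgraph_map_graph[OF assms(1,2) H(1)] complete_map_graph[OF H(2)] by blast
qed

text \<open>Injectivity passes from \<open>G\<close> to the induced subgraph \<open>H\<close>, and
  from there to the complete graph \<open>K\<close>, whose vertices survive in its subdivision
  \<open>H\<close>.\<close>

lemma contains_ISK4_map_graph:
  assumes "pair_graph G" "inj_on f (pverts G)" "contains_ISK4 G"
  shows "contains_ISK4 (map_graph f G)"
proof -
  obtain H K where H: "induced_subgraph (with_proj H) (with_proj G)"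
    and K: "K\<^bsub>4\<^esub> (with_proj K)" "subdivision_pair K H"
    using assms(3) unfolding contains_ISK4_def ISK4_of_def by blast
  have inj: "inj_on f (pverts H)"
    using assms(1,2) H by (auto simp: induced_subgraph_pair_iff intro: inj_on_subset)
  then have "inj_on f (pverts K)"
    using subdivision_pair_pverts_subset[OF K(2)] by (rule inj_on_subset)
  then show ?thesis unfolding contains_ISK4_def ISK4_of_def
    using induced_subgraph_map_graph[OF assms(1,2) H] complete_map_graph[OF K(1)]
      subdivision_pair_map_graph[OF K(2) inj] by blast
qed

lemma colorable_map_graphD:
  assumes "colorable k (map_graph f G)"
  shows "colorable k G"
proof -
  obtain c where "\<forall>v\<in>f ` pverts G. c v < k" "\<forall>(u, v)\<in>map_prod f f ` parcs G. c u \<noteq> c v"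
    using assms unfolding colorable_def by auto
  then show ?thesis
    unfolding colorable_def by (intro exI[of _ "c \<circ> f"]) auto
qed

subsection \<open>Subdivisions of \<open>K\<^sub>4\<close> formed by a biclique and a path\<close>

definition path_arcs :: "'a list \<Rightarrow> ('a \<times> 'a) set" where
  "path_arcs xs = set (zip xs (tl xs)) \<union> (set (zip xs (tl xs)))\<inverse>"

lemma path_arcs_simps [simp]:
  "path_arcs [] = {}" "path_arcs [x] = {}"
  "path_arcs (x # y # zs) = {(x, y), (y, x)} \<union> path_arcs (y # zs)"
  by (auto simp: path_arcs_def)

text \<open>After one step the edge still to be subdivided joins \<open>w\<close> to
  \<open>v\<close>, so the first end moves along the list while \<open>v\<close> stays
  fixed.\<close>

fun subdivide_path :: "'a pair_pre_digraph \<Rightarrow> 'a \<Rightarrow> 'a \<Rightarrow> 'a list \<Rightarrow> 'a pair_pre_digraph" where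
  "subdivide_path G u v [] = G"
| "subdivide_path G u v (w # ws) = subdivide_path (subdivide G (u, v) w) w v ws"

lemma subdivision_pair_subdivide_path:
  assumes "subdivision_pair K G" "(u, v) \<in> parcs G" "distinct ws" "set ws \<inter> pverts G = {}"
  shows "subdivision_pair K (subdivide_path G u v ws)"
  using assms
proof (induction ws arbitrary: G u)
  case (Cons w ws)
  have "subdivision_pair K (subdivide G (u, v) w)"
    using Cons.prems by (intro subdivision_pair_divide) auto
  then show ?case using Cons.prems by (auto intro!: Cons.IH)
qed simp

lemma pverts_subdivide_path: "pverts (subdivide_path G u v ws) = pverts G \<union> set ws"
  by (induction ws arbitrary: G u) auto

lemma parcs_subdivide_path:
  assumes "pair_bidirected_digraph G" "(u, v) \<in> parcs G" "distinct ws" "set ws \<inter> pverts G = {}"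
  shows "parcs (subdivide_path G u v ws) = parcs G - {(u, v), (v, u)} \<union> path_arcs (u # ws @ [v])"
  using assms
proof (induction ws arbitrary: G u)
  case Nil
  then interpret pair_bidirected_digraph G by simp
  have "(v, u) \<in> parcs G" using Nil(2) by (rule arcs_symmetric)
  then show ?case using Nil(2) by auto
next
  case (Cons w ws)
  interpret pair_bidirected_digraph G by fact
  have w: "(x, w) \<notin> parcs G" "(w, x) \<notin> parcs G" for x
    using Cons.prems(4) wellformed'[of x w] wellformed'[of w x] by auto
  have uv: "u \<in> pverts G" "v \<in> pverts G" using wellformed'[OF Cons.prems(2)] by auto
  have "parcs (subdivide_path (subdivide G (u, v) w) w v ws) =
      parcs (subdivide G (u, v) w) - {(w, v), (v, w)} \<union> path_arcs (w # ws @ [v])"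
    using Cons.prems by (intro Cons.IH pair_bidirected_digraph_subdivide) auto
  \<comment> \<open>The vertex \<open>w\<close> is new, so removing its edge to \<open>v\<close> in
    the next round deletes no arc of the original graph.\<close>
  moreover have "{(w, v), (v, w), (u, w), (w, u)} \<inter> parcs G = {}" "u \<noteq> v" "u \<noteq> w" "v \<noteq> w"
    using w uv Cons.prems(4) no_loops'[OF Cons.prems(2)] by auto
  ultimately show ?case by auto
qed

text \<open>Intended roles: \<open>A\<close> holds the two ends of the path, \<open>Z\<close> the
  third vertex of their side, \<open>B\<close> two vertices of the other side and \<open>P\<close>
  the inner vertices of the path. The arcs inside \<open>A \<union> P\<close> stay one term, to be
  matched with \<open>path_arcs\<close>.\<close>

lemma restrict_Un_biclique:
  assumes "E \<inter> (A \<union> Z) \<times> (A \<union> Z) = {}" "E \<inter> B \<times> B = {}"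
    "E \<inter> P \<times> (Z \<union> B) = {}" "E \<inter> (Z \<union> B) \<times> P = {}"
    "(A \<union> Z) \<times> B \<subseteq> E" "B \<times> (A \<union> Z) \<subseteq> E"
  shows "E \<inter> (A \<union> Z \<union> B \<union> P) \<times> (A \<union> Z \<union> B \<union> P) =
    (A \<union> Z) \<times> B \<union> B \<times> (A \<union> Z) \<union> E \<inter> (A \<union> P) \<times> (A \<union> P)"
proof (intro equalityI subrelI)
  fix x y assume xy: "(x, y) \<in> E \<inter> (A \<union> Z \<union> B \<union> P) \<times> (A \<union> Z \<union> B \<union> P)"
  have "\<not> (x \<in> A \<union> Z \<and> y \<in> A \<union> Z)" using xy assms(1) by blast
  moreover have "\<not> (x \<in> B \<and> y \<in> B)" using xy assms(2) by blast
  moreover have "\<not> (x \<in> P \<and> y \<in> Z \<union> B)" using xy assms(3) by blast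
  moreover have "\<not> (x \<in> Z \<union> B \<and> y \<in> P)" using xy assms(4) by blast
  ultimately show "(x, y) \<in> (A \<union> Z) \<times> B \<union> B \<times> (A \<union> Z) \<union> E \<inter> (A \<union> P) \<times> (A \<union> P)"
    using xy by simp argo
next
  fix x y assume "(x, y) \<in> (A \<union> Z) \<times> B \<union> B \<times> (A \<union> Z) \<union> E \<inter> (A \<union> P) \<times> (A \<union> P)"
  then show "(x, y) \<in> E \<inter> (A \<union> Z \<union> B \<union> P) \<times> (A \<union> Z \<union> B \<union> P)"
    using subsetD[OF assms(5), of "(x, y)"] subsetD[OF assms(6), of "(x, y)"] by simp argo
qed

text \<open>The \<open>K\<^sub>4\<close> lives on \<open>a1\<close>, \<open>a2\<close>,
  \<open>b1\<close>, \<open>b2\<close>. Its four edges between the sides are present in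
  \<open>G\<close>; the edge \<open>b1 b2\<close> is subdivided by \<open>a3\<close>, and the edge
  \<open>a1 a2\<close> by the vertices of \<open>ps\<close>.\<close>

lemma contains_ISK4_biclique_path:
  assumes G: "pair_graph G"
    and a: "a1 \<noteq> a2" "a1 \<noteq> a3" "a2 \<noteq> a3" and b: "b1 \<noteq> b2"
    and ab: "{a1, a2, a3} \<times> {b1, b2} \<subseteq> parcs G"
    and nadj: "parcs G \<inter> {a1, a2, a3} \<times> {a1, a2, a3} = {}" "(b1, b2) \<notin> parcs G"
    and ps: "set ps \<subseteq> pverts G" "distinct ps" "ps \<noteq> []"
      "set ps \<inter> {a1, a2, a3, b1, b2} = {}"
      "parcs G \<inter> set ps \<times> {a3, b1, b2} = {}"
    and path: "parcs G \<inter> set (a1 # ps @ [a2]) \<times> set (a1 # ps @ [a2]) = path_arcs (a1 # ps @ [a2])"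
  shows "contains_ISK4 G"
proof -
  have *: "parcs G \<subseteq> pverts G \<times> pverts G" "sym (parcs G)" "irrefl (parcs G)"
    using G by (auto simp: pair_graph_iff)
  have dis: "{a1, a2, a3} \<inter> {b1, b2} = {}"
    using ab *(3) by (auto simp: irrefl_def)
  define W where "W = {a1, a2, b1, b2}"
  define K where "K = \<lparr>pverts = W, parcs = {(u, v). (u, v) \<in> W \<times> W \<and> u \<noteq> v}\<rparr>"
  have K4: "K\<^bsub>4\<^esub> (with_proj K)"
    unfolding complete_digraph_pair_def K_def W_def using a b dis by auto
  then interpret K: graph "with_proj K" by (simp add: complete_digraph_def)
  interpret K: pair_graph K by (rule pair_graphI_graph) (rule K.graph_axioms)
  define K' where "K' = subdivide K (b1, b2) a3"
  have "(b1, b2) \<in> parcs K" "a3 \<notin> pverts K"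
    using a b dis by (auto simp: K_def W_def)
  moreover have "subdivision_pair K K"
    by (rule subdivision_pair_base) (rule K.pair_bidirected_digraph_axioms)
  ultimately have sd: "subdivision_pair K K'"
    unfolding K'_def by (intro subdivision_pair_divide)
  have vK': "pverts K' = {a1, a2, a3, b1, b2}"
    by (auto simp: K'_def K_def W_def)
  have aK': "parcs K' = {(a1, a2), (a2, a1)} \<union> {a1, a2, a3} \<times> {b1, b2} \<union> {b1, b2} \<times> {a1, a2, a3}"
    using a b dis by (auto simp: K'_def K_def W_def)
  define H where "H = subdivide_path K' a1 a2 ps"
  have ps': "(a1, a2) \<in> parcs K'" "set ps \<inter> pverts K' = {}"
    using aK' vK' ps(4) by auto
  have "subdivision_pair K H" unfolding H_def
    using sd ps'(1) ps(2) ps'(2) by (rule subdivision_pair_subdivide_path)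
  moreover have vH: "pverts H = {a1, a2} \<union> {a3} \<union> {b1, b2} \<union> set ps"
    by (auto simp: H_def pverts_subdivide_path vK')
  have path': "path_arcs (a1 # ps @ [a2]) = parcs G \<inter> ({a1, a2} \<union> set ps) \<times> ({a1, a2} \<union> set ps)"
    unfolding path[symmetric] by auto
  have aH: "parcs H = ({a1, a2} \<union> {a3}) \<times> {b1, b2} \<union> {b1, b2} \<times> ({a1, a2} \<union> {a3})
      \<union> path_arcs (a1 # ps @ [a2])"
    unfolding H_def parcs_subdivide_path[OF bidirected_digraphI_subdivision[OF sd] ps'(1) ps(2) ps'(2)]
    unfolding aK' using dis by auto
  have "parcs H = parcs G \<inter> pverts H \<times> pverts H"
    unfolding aH vH path'
  proof (rule restrict_Un_biclique[symmetric])
    show "parcs G \<inter> ({a1, a2} \<union> {a3}) \<times> ({a1, a2} \<union> {a3}) = {}"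
      using nadj(1) by (metis Un_insert_left insert_is_Un)
    show "parcs G \<inter> set ps \<times> ({a3} \<union> {b1, b2}) = {}"
      using ps(5) by (metis insert_is_Un)
    then show "parcs G \<inter> ({a3} \<union> {b1, b2}) \<times> set ps = {}"
      using *(2) by (auto dest: symD)
    show "({a1, a2} \<union> {a3}) \<times> {b1, b2} \<subseteq> parcs G"
      using ab by (metis Un_insert_left insert_is_Un)
    then show "{b1, b2} \<times> ({a1, a2} \<union> {a3}) \<subseteq> parcs G"
      using *(2) by (auto dest: symD)
    show "parcs G \<inter> {b1, b2} \<times> {b1, b2} = {}"
      using nadj(2) *(2,3) by (auto simp: irrefl_def dest: symD)
  qed
  moreover have "pverts H \<subseteq> pverts G"
    unfolding vH using ab *(1) ps(1) by auto
  ultimately show ?thesis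
    unfolding contains_ISK4_def ISK4_of_def induced_subgraph_pair_iff[OF G] using K4 by blast
qed

section \<open>Walks as lists and chordless paths\<close>

text \<open>The last assumption forbids chords, that is, arcs between entries with at least one
  entry in between. Peeling off the first entry leaves its arcs to and from the second as the only
  new ones.\<close>

lemma successively_Restr_path_arcs:
  assumes "sym E" "irrefl E" "successively (\<lambda>u v. (u, v) \<in> E) xs"
    and "\<And>us u ms v vs. xs = us @ u # ms @ v # vs \<Longrightarrow> ms \<noteq> [] \<Longrightarrow> (u, v) \<notin> E"
  shows "E \<inter> set xs \<times> set xs = path_arcs xs"
  using assms(3,4)
proof (induction xs rule: induct_list012)
  case (3 x y zs)
  have IH: "E \<inter> set (y # zs) \<times> set (y # zs) = path_arcs (y # zs)"
  proof (rule "3.IH"(2))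
    fix us u ms v vs assume "y # zs = us @ u # ms @ v # vs" "ms \<noteq> []"
    then show "(u, v) \<notin> E" using "3.prems"(2)[of "x # us" u ms v vs] by simp
  qed (use "3.prems"(1) in simp)
  have xz: "(x, z) \<notin> E" if "z \<in> set zs" for z
  proof -
    obtain ms vs where "zs = ms @ z # vs" using \<open>z \<in> set zs\<close> by (meson split_list)
    then show ?thesis using "3.prems"(2)[of "[]" x "y # ms" z vs] by simp
  qed
  have "(x, y) \<in> E" "(y, x) \<in> E" "(x, x) \<notin> E" "\<And>z. z \<in> set zs \<Longrightarrow> (z, x) \<notin> E"
    using "3.prems"(1) assms(1,2) xz by (auto simp: irrefl_def dest: symD)
  with xz have "E \<inter> {x} \<times> set (x # y # zs) = {(x, y)}" "E \<inter> set (x # y # zs) \<times> {x} = {(y, x)}"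
    by auto
  moreover have "E \<inter> set (x # y # zs) \<times> set (x # y # zs) =
      E \<inter> {x} \<times> set (x # y # zs) \<union> E \<inter> set (x # y # zs) \<times> {x} \<union> E \<inter> set (y # zs) \<times> set (y # zs)"
    unfolding list.set(2)[of x] by blast
  ultimately show ?case unfolding IH path_arcs_simps by (metis insert_is_Un Un_commute)
qed (use assms(2) in \<open>auto simp: irrefl_def\<close>)

lemma successively_shortcut:
  assumes "successively P (us @ u # ms @ v # vs)" "P u v"
  shows "successively P (us @ u # v # vs)"
  using assms by (auto simp: successively_append_iff successively_Cons)

text \<open>Serves to cut an attached path at an inner vertex \<open>w\<close> with a neighbour
  \<open>z\<close> in the biclique; either part then ends in \<open>z\<close>.\<close>

lemma successively_new_ends:
  assumes "successively P (us @ w # vs)"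
  shows "P w z \<Longrightarrow> successively P (us @ [w, z])" "P z w \<Longrightarrow> successively P (z # w # vs)"
  using assms by (auto simp: successively_append_iff)

text \<open>The bound on \<open>set ps\<close> keeps the walk inside the component of
  \<open>x\<close>.\<close>

lemma rtrancl_successively:
  assumes "(x, y) \<in> R\<^sup>*"
  obtains ps where "ps \<noteq> []" "hd ps = x" "last ps = y" "set ps \<subseteq> R\<^sup>* `` {x}"
    "successively (\<lambda>u v. (u, v) \<in> R) ps"
proof -
  have "\<exists>ps. ps \<noteq> [] \<and> hd ps = x \<and> last ps = y \<and> set ps \<subseteq> R\<^sup>* `` {x} \<and>
      successively (\<lambda>u v. (u, v) \<in> R) ps"
    using assms
  proof (induction rule: rtrancl_induct)
    case base
    show ?case by (rule exI[of _ "[x]"]) simp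
  next
    case (step y z)
    then obtain ps where "ps \<noteq> []" "hd ps = x" "last ps = y" "set ps \<subseteq> R\<^sup>* `` {x}"
      "successively (\<lambda>u v. (u, v) \<in> R) ps" by blast
    with step.hyps show ?case
      by (intro exI[of _ "ps @ [z]"]) (auto simp: successively_append_iff)
  qed
  then show thesis using that by blast
qed

subsection \<open>Attachments to a maximal biclique\<close>

text \<open>A vertex complete to \<open>A\<close> could join \<open>B\<close>, and vice versa, so
  maximality is tested against single vertices. The bounds on \<open>card\<close> also force both
  sides to be finite, infinite sets having cardinality 0.\<close>

definition maximal_biclique :: "'a pair_pre_digraph \<Rightarrow> 'a set \<Rightarrow> 'a set \<Rightarrow> bool" where
  "maximal_biclique G A B \<longleftrightarrow>
     A \<subseteq> pverts G \<and> B \<subseteq> pverts G \<and> 3 \<le> card A \<and> 3 \<le> card B \<and> A \<times> B \<subseteq> parcs G \<and>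
     (\<forall>v \<in> pverts G - (A \<union> B). \<not> A \<times> {v} \<subseteq> parcs G \<and> \<not> B \<times> {v} \<subseteq> parcs G)"

lemma maximal_biclique_sym:
  assumes "sym (parcs G)"
  shows "maximal_biclique G A B \<longleftrightarrow> maximal_biclique G B A"
proof -
  have "A \<times> B \<subseteq> parcs G \<longleftrightarrow> B \<times> A \<subseteq> parcs G"
    using assms by (auto simp: subset_iff dest: symD)
  then show ?thesis unfolding maximal_biclique_def Un_commute[of A B] by blast
qed

text \<open>Vertices of \<open>ps\<close> may repeat; only shortest such walks are shown to be induced paths.\<close>

definition attached_path :: "'a pair_pre_digraph \<Rightarrow> 'a set \<Rightarrow> 'a set \<Rightarrow> 'a \<Rightarrow> 'a list \<Rightarrow> 'a \<Rightarrow> bool" where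
  "attached_path G A B x ps y \<longleftrightarrow> ps \<noteq> [] \<and> x \<noteq> y \<and> ({x, y} \<subseteq> A \<or> {x, y} \<subseteq> B) \<and>
     set ps \<subseteq> pverts G - (A \<union> B) \<and> successively (\<lambda>u v. (u, v) \<in> parcs G) (x # ps @ [y])"

lemma attached_path_sym: "attached_path G A B = attached_path G B A"
  unfolding attached_path_def by (intro ext) (auto simp: Un_commute)

lemma obtain_two_distinct:
  assumes "2 \<le> card S"
  obtains x y where "x \<in> S" "y \<in> S" "x \<noteq> y"
proof -
  have "finite S" using assms by (auto intro: card_ge_0_finite)
  then have "\<not> (\<forall>x\<in>S. \<forall>y\<in>S. x = y)" using assms card_le_Suc0_iff_eq[of S] by auto
  then show thesis using that by blast
qed

text \<open>Minimal length makes the path chordless, yields a third vertex of \<open>A\<close>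
  without neighbours on \<open>ps\<close>, and leaves at most one vertex of \<open>B\<close> with a
  neighbour on \<open>ps\<close>. The assumption \<open>short\<close> ranges over paths attached to
  either side, since the part about \<open>B\<close> compares with paths whose ends lie in
  \<open>B\<close>.\<close>

lemma contains_ISK4_shortest_attached_path:
  assumes G: "pair_graph G" and tf: "\<not> contains_triangle G" and max: "maximal_biclique G A B"
    and path: "attached_path G A B x ps y" and xy: "x \<in> A" "y \<in> A"
    and short: "\<And>x' ps' y'. attached_path G A B x' ps' y' \<Longrightarrow> length ps \<le> length ps'"
  shows "contains_ISK4 G"
proof -
  let ?E = "parcs G" and ?adj = "\<lambda>u v. (u, v) \<in> parcs G"
  have E: "?E \<subseteq> pverts G \<times> pverts G" "sym ?E" "irrefl ?E"
    using G by (auto simp: pair_graph_iff)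
  have no_tri: False if "(a, b) \<in> ?E" "(b, c) \<in> ?E" "(a, c) \<in> ?E" for a b c
    using contains_triangleI[OF G that] tf by simp
  have AB: "A \<subseteq> pverts G" "B \<subseteq> pverts G" "3 \<le> card A" "3 \<le> card B"
    "\<And>a b. a \<in> A \<Longrightarrow> b \<in> B \<Longrightarrow> (a, b) \<in> ?E"
    "\<And>v. v \<in> pverts G - (A \<union> B) \<Longrightarrow> \<not> A \<times> {v} \<subseteq> ?E"
    using max unfolding maximal_biclique_def by auto
  have BA: "\<And>a b. a \<in> A \<Longrightarrow> b \<in> B \<Longrightarrow> (b, a) \<in> ?E" using AB(5) E(2) by (auto dest: symD)
  have ps: "ps \<noteq> []" "x \<noteq> y" "set ps \<subseteq> pverts G - (A \<union> B)" and
    suc: "successively ?adj (x # ps @ [y])"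
    using path unfolding attached_path_def by auto
  have fin: "finite A" "finite B" using AB(3,4) by (auto intro: card_ge_0_finite)
  have "A \<noteq> {}" "B \<noteq> {}" using AB(3,4) by auto
  then obtain a0 b0 where ab0: "a0 \<in> A" "b0 \<in> B" by auto
  have indA: "(a, a') \<notin> ?E" if "a \<in> A" "a' \<in> A" for a a'
    using no_tri[of a a' b0] AB(5) ab0 that by blast
  have indB: "(b, b') \<notin> ?E" if "b \<in> B" "b' \<in> B" for b b'
    using no_tri[of b b' a0] BA ab0 that by blast
  \<comment> \<open>A chord would give a shorter attached path between \<open>x\<close> and
    \<open>y\<close>; the chord from \<open>x\<close> to \<open>y\<close> itself is excluded by the
    independence of \<open>A\<close>. The cases ask whether the chord starts at \<open>x\<close>
    (\<open>us\<close> empty) and ends at \<open>y\<close> (\<open>vs\<close> empty).\<close>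
  have chord: "(u, v) \<notin> ?E" if dec: "x # ps @ [y] = us @ u # ms @ v # vs" "ms \<noteq> []" for us u ms v vs
  proof
    assume "(u, v) \<in> ?E"
    then have sc: "successively ?adj (us @ u # v # vs)"
      using successively_shortcut[of ?adj us u ms v vs] suc unfolding dec(1) by blast
    show False
    proof (cases us)
      case Nil
      then have [simp]: "u = x" and dec': "ps @ [y] = ms @ v # vs" using dec by auto
      show False
      proof (cases vs rule: rev_cases)
        case Nil
        then have "v = y" using dec' by auto
        then show False using \<open>(u, v) \<in> ?E\<close> indA xy by simp
      next
        case (snoc vs' z)
        then have z: "z = y" "ps = ms @ v # vs'" using dec' by auto
        have "attached_path G A B x (v # vs') y"
          using ps xy sc \<open>us = []\<close> snoc unfolding attached_path_def z by auto
        then show False using short[of x "v # vs'" y] z dec(2) by simp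
      qed
    next
      case (Cons w us')
      then have [simp]: "w = x" and dec': "ps @ [y] = us' @ u # ms @ v # vs" using dec by auto
      show False
      proof (cases vs rule: rev_cases)
        case Nil
        then have z: "v = y" "ps = us' @ u # ms"
          using dec' by (metis append_Cons append_assoc append1_eq_conv)+
        have "attached_path G A B x (us' @ [u]) y"
          using ps xy sc Cons Nil unfolding attached_path_def z by auto
        then show False using short[of x "us' @ [u]" y] z dec(2) by simp
      next
        case (snoc vs' z)
        then have z: "z = y" "ps = us' @ u # ms @ v # vs'"
          using dec' by (metis append_Cons append_assoc append1_eq_conv)+
        have "attached_path G A B x (us' @ u # v # vs') y"
          using ps xy sc Cons snoc unfolding attached_path_def z by auto
        then show False using short[of x "us' @ u # v # vs'" y] z dec(2) by simp
      qed
    qed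
  qed
  have induced: "?E \<inter> set (x # ps @ [y]) \<times> set (x # ps @ [y]) = path_arcs (x # ps @ [y])"
    using E(2,3) suc chord by (rule successively_Restr_path_arcs)
  have dist: "distinct ps"
  proof (rule ccontr)
    assume "\<not> distinct ps"
    then obtain us w ms vs where dec: "ps = us @ w # ms @ w # vs"
      using not_distinct_decomp[of ps] by auto
    \<comment> \<open>The successor \<open>n\<close> of the second occurrence of \<open>w\<close>,
      possibly \<open>y\<close>, is adjacent to \<open>w\<close>; seen from the first occurrence
      this arc is a chord.\<close>
    obtain n ns where n: "vs @ [y] = n # ns" by (cases "vs @ [y]") auto
    have "x # ps @ [y] = (x # us) @ w # (ms @ [w]) @ n # ns" using dec n by simp
    moreover from this suc have "(w, n) \<in> ?E" by (simp add: successively_append_iff successively_Cons)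
    ultimately show False using chord by blast
  qed
  have hdps: "(x, hd ps) \<in> ?E" using suc ps(1) by (simp add: successively_Cons)
  \<comment> \<open>If \<open>ps\<close> is a single vertex, maximality of the biclique supplies a
    non-neighbour in \<open>A\<close>. Otherwise any third vertex of \<open>A\<close> works: a
    neighbour \<open>w\<close> on \<open>ps\<close> would split the path into two attached paths,
    and minimality applied to both forces \<open>ps = [w]\<close>.\<close>
  obtain a where a: "a \<in> A" "a \<noteq> x" "a \<noteq> y" "\<And>w. w \<in> set ps \<Longrightarrow> (w, a) \<notin> ?E"
  proof (cases "\<exists>w. ps = [w]")
    case True
    then obtain w where w: "ps = [w]" by blast
    obtain a where a: "a \<in> A" "(a, w) \<notin> ?E" using AB(6)[of w] ps(3) w by auto
    have "(x, w) \<in> ?E" "(y, w) \<in> ?E" using suc w E(2) by (auto dest: symD)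
    then have "a \<noteq> x" "a \<noteq> y" using a by auto
    moreover have "(w, a) \<notin> ?E" using a E(2) by (auto dest: symD)
    ultimately show thesis using that[of a] a w by auto
  next
    case False
    have "card {x, y} < card A" using AB(3) ps(2) by simp
    then have "\<not> A \<subseteq> {x, y}" by (meson card_mono finite.emptyI finite.insertI not_less)
    then obtain a where a: "a \<in> A" "a \<noteq> x" "a \<noteq> y" by auto
    have "(w, a) \<notin> ?E" if w: "w \<in> set ps" for w
    proof
      assume wa: "(w, a) \<in> ?E"
      then have aw: "(a, w) \<in> ?E" using E(2) by (auto dest: symD)
      obtain us vs where dec: "ps = us @ w # vs" using w by (meson split_list)
      have "attached_path G A B x (us @ [w]) a" "attached_path G A B a (w # vs) y"
        using ps xy a successively_new_ends[of ?adj "x # us" w "vs @ [y]" a] suc wa aw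
        unfolding attached_path_def dec by auto
      then have "vs = []" "us = []" using short dec by fastforce+
      then show False using dec False by simp
    qed
    then show thesis using that a by blast
  qed
  \<comment> \<open>Two attachments to \<open>B\<close> would cut out a shorter path, unless they sit at the two ends of \<open>ps\<close>,
    where an attachment to \<open>B\<close> gives a triangle with \<open>x\<close>.\<close>
  have uniq: "z = z'" if "ps = us @ ms @ vs" "ms \<noteq> []" "(hd ms, z) \<in> ?E" "(last ms, z') \<in> ?E" "z \<in> B" "z' \<in> B"
    for us ms vs z z'
  proof (rule ccontr)
    assume "z \<noteq> z'"
    moreover have "(z, hd ms) \<in> ?E" using that(3) E(2) by (auto dest: symD)
    ultimately have "attached_path G A B z ms z'"
      using ps(3) suc that unfolding attached_path_def
      by (auto simp: successively_append_iff successively_Cons)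
    then have "ms = ps" using short[of z ms z'] that(1) by simp
    then show False using no_tri[OF hdps] that(3,5) AB(5) xy by blast
  qed
  define U where "U = {b \<in> B. \<exists>w \<in> set ps. (w, b) \<in> ?E}"
  have "z = z'" if zU: "z \<in> U" "z' \<in> U" for z z'
  proof -
    obtain w w' where w: "w \<in> set ps" "(w, z) \<in> ?E" "w' \<in> set ps" "(w', z') \<in> ?E" "z \<in> B" "z' \<in> B"
      using zU unfolding U_def by auto
    obtain us vs where dec: "ps = us @ w # vs" using w(1) by (meson split_list)
    \<comment> \<open>The stretch between the two attachment vertices is handed to
      \<open>uniq\<close>, in the order in which they occur on \<open>ps\<close>.\<close>
    consider "w' = w" | "w' \<in> set vs" | "w' \<in> set us" using w(3) dec by auto
    then show ?thesis
    proof cases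
      case 1
      then show ?thesis using uniq[of us "[w]" vs z z'] dec w by simp
    next
      case 2
      then obtain ms vs' where "vs = ms @ w' # vs'" by (meson split_list)
      then show ?thesis using uniq[of us "w # ms @ [w']" vs' z z'] dec w by simp
    next
      case 3
      then obtain us' ms where "us = us' @ w' # ms" by (meson split_list)
      then show ?thesis using uniq[of us' "w' # ms @ [w]" vs z' z] dec w by simp
    qed
  qed
  \<comment> \<open>At least two of the three or more vertices of \<open>B\<close> thus have no
    neighbour on \<open>ps\<close>.\<close>
  then have "card U \<le> 1"
    using card_le_Suc0_iff_eq[of U] fin(2) by (auto simp: U_def)
  then have "2 \<le> card (B - U)"
    using AB(4) fin(2) by (subst card_Diff_subset) (auto simp: U_def)
  then obtain b1 b2 where b: "b1 \<in> B - U" "b2 \<in> B - U" "b1 \<noteq> b2" by (rule obtain_two_distinct)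
  then have bU: "b1 \<in> B" "b2 \<in> B" "\<And>w. w \<in> set ps \<Longrightarrow> (w, b1) \<notin> ?E" "\<And>w. w \<in> set ps \<Longrightarrow> (w, b2) \<notin> ?E"
    unfolding U_def by auto
  show ?thesis
  proof (rule contains_ISK4_biclique_path[OF G ps(2) a(2,3)[symmetric] b(3)])
    show "{x, y, a} \<times> {b1, b2} \<subseteq> ?E" using AB(5) xy a(1) bU by simp
    show "?E \<inter> {x, y, a} \<times> {x, y, a} = {}" using indA xy a(1) by simp
    show "(b1, b2) \<notin> ?E" using indB bU by simp
    show "set ps \<subseteq> pverts G" "distinct ps" "ps \<noteq> []" using ps dist by auto
    show "set ps \<inter> {x, y, a, b1, b2} = {}" using ps(3) xy a(1) bU(1,2) by blast
    show "?E \<inter> set ps \<times> {a, b1, b2} = {}" using a(4) bU(3,4) by blast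
  qed (rule induced)
qed

text \<open>The shortest path is chosen among those attached to either side; symmetry of the
  biclique covers the case that its ends lie in \<open>B\<close>.\<close>

lemma no_attached_path:
  assumes G: "pair_graph G" and "\<not> contains_triangle G" "\<not> contains_ISK4 G"
    and max: "maximal_biclique G A B"
  shows "\<not> attached_path G A B x ps y"
proof
  assume path: "attached_path G A B x ps y"
  have "sym (parcs G)" using G by (simp add: pair_graph_iff)
  then have max': "maximal_biclique G B A" using max maximal_biclique_sym by blast
  define P where "P n \<longleftrightarrow> (\<exists>x ps y. attached_path G A B x ps y \<and> length ps = n)" for n
  have "P (length ps)" using path unfolding P_def by blast
  then have "P (Least P)" by (rule LeastI)
  then obtain x' ps' y' where path': "attached_path G A B x' ps' y'" and len: "length ps' = Least P"
    unfolding P_def[of "Least P"] by blast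
  have short: "length ps' \<le> length qs" if "attached_path G A B u qs v" for u qs v
    unfolding len using that by (intro Least_le) (auto simp: P_def)
  have "x' \<in> A \<and> y' \<in> A \<or> x' \<in> B \<and> y' \<in> B"
    using path' unfolding attached_path_def by auto
  then have "contains_ISK4 G"
  proof
    assume "x' \<in> A \<and> y' \<in> A"
    then show ?thesis
      using contains_ISK4_shortest_attached_path[OF assms(1,2) max path'] short by blast
  next
    assume "x' \<in> B \<and> y' \<in> B"
    then show ?thesis
      using contains_ISK4_shortest_attached_path[OF assms(1,2) max', unfolded attached_path_sym[of G B A], OF path']
        short by blast
  qed
  then show False using assms(3) by simp
qed

section \<open>Clique cutsets from maximal bicliques\<close>

lemma ex_maximal_biclique:
  assumes G: "pair_graph G" and "contains_K33 G"
  shows "\<exists>A B. maximal_biclique G A B"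
proof -
  have E: "sym (parcs G)" and fin: "finite (pverts G)"
    using G by (auto simp: pair_graph_iff)
  define P where "P = (\<lambda>(A, B). A \<subseteq> pverts G \<and> B \<subseteq> pverts G \<and> 3 \<le> card A \<and> 3 \<le> card B \<and>
    A \<times> B \<subseteq> parcs G)"
  define s :: "'a set \<times> 'a set \<Rightarrow> nat" where "s = (\<lambda>(A, B). card A + card B)"
  obtain H where H: "induced_subgraph (with_proj H) (with_proj G)" "K\<^bsub>3,3\<^esub> (with_proj H)"
    using assms(2) unfolding contains_K33_def by blast
  obtain U W where UW: "pverts H = U \<union> W" "card U = 3" "card W = 3" "parcs H = U \<times> W \<union> W \<times> U"
    using H(2) unfolding complete_bipartite_digraph_pair_def by blast
  have "P (U, W)"
    using H(1) UW unfolding P_def induced_subgraph_pair_iff[OF G] by auto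
  \<comment> \<open>The \<open>+ 1\<close> is there because the rule for greatest elements expects a
    strict bound.\<close>
  moreover have "\<forall>p. P p \<longrightarrow> s p < 2 * card (pverts G) + 1"
  proof (intro allI impI)
    fix p assume "P p"
    then have "card (fst p) \<le> card (pverts G)" "card (snd p) \<le> card (pverts G)"
      using fin by (auto simp: P_def intro!: card_mono)
    then show "s p < 2 * card (pverts G) + 1" by (auto simp: s_def split: prod.split)
  qed
  ultimately obtain p where "P p" "\<forall>q. P q \<longrightarrow> s q \<le> s p"
    using ex_has_greatest_nat[of P _ s] by blast
  then obtain A B where AB: "P (A, B)" and greatest: "\<And>A' B'. P (A', B') \<Longrightarrow> s (A', B') \<le> s (A, B)"
    by (cases p) blast
  have finAB: "finite A" "finite B" using AB fin by (auto simp: P_def intro: finite_subset)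
  have "\<not> A \<times> {v} \<subseteq> parcs G \<and> \<not> B \<times> {v} \<subseteq> parcs G" if v: "v \<in> pverts G - (A \<union> B)" for v
  proof (intro conjI notI)
    assume "A \<times> {v} \<subseteq> parcs G"
    then have "P (A, insert v B)"
      using AB v finAB by (auto simp: P_def)
    then show False using greatest[of A "insert v B"] v finAB by (simp add: s_def)
  next
    assume "B \<times> {v} \<subseteq> parcs G"
    then have "{v} \<times> B \<subseteq> parcs G" using E by (auto dest: symD)
    then have "P (insert v A, B)"
      using AB v finAB by (auto simp: P_def)
    then show False using greatest[of "insert v A" B] v finAB by (simp add: s_def)
  qed
  then show ?thesis using AB unfolding maximal_biclique_def P_def by blast
qed

text \<open>Triangle-freeness makes both sides independent, so the side of a vertex can serve as its
  colour.\<close>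

lemma colorable_biclique:
  assumes G: "pair_graph G" and tf: "\<not> contains_triangle G" and max: "maximal_biclique G A B"
    and V: "pverts G = A \<union> B" and k: "2 \<le> k"
  shows "colorable k G"
proof -
  have E: "parcs G \<subseteq> pverts G \<times> pverts G" "sym (parcs G)"
    using G by (auto simp: pair_graph_iff)
  have no_tri: False if "(a, b) \<in> parcs G" "(b, c) \<in> parcs G" "(a, c) \<in> parcs G" for a b c
    using contains_triangleI[OF G that] tf by simp
  have AB: "\<And>a b. a \<in> A \<Longrightarrow> b \<in> B \<Longrightarrow> (a, b) \<in> parcs G" "A \<noteq> {}" "B \<noteq> {}"
    using max unfolding maximal_biclique_def by auto
  then obtain a0 b0 where "a0 \<in> A" "b0 \<in> B" by auto
  have "(u, v) \<notin> parcs G" if "u \<in> A" "v \<in> A" for u v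
    using no_tri[of u v b0] AB(1) \<open>b0 \<in> B\<close> that by blast
  moreover have "(u, v) \<notin> parcs G" if "u \<in> B" "v \<in> B" for u v
    using no_tri[of u v a0] AB(1) E(2) \<open>a0 \<in> A\<close> that by (meson symD)
  ultimately have "u \<in> A \<longleftrightarrow> v \<notin> A" if "(u, v) \<in> parcs G" for u v
    using that subsetD[OF E(1) that] V by auto
  then have "\<forall>(u, v)\<in>parcs G. (if u \<in> A then 0 else 1 :: nat) \<noteq> (if v \<in> A then 0 else 1)"
    by (simp add: Ball_def)
  then show ?thesis
    unfolding colorable_def using k by (intro exI[of _ "\<lambda>v. if v \<in> A then 0 else 1"] conjI) simp_all
qed

text \<open>For a component \<open>C\<close> outside the biclique and its set \<open>K\<close> of
  neighbours in the biclique, take \<open>S = pverts G - C\<close> and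
  \<open>T = C \<union> K\<close>. They meet exactly in \<open>K\<close>, which has at most one
  vertex on each side and is therefore a clique.\<close>

lemma biclique_clique_cutset:
  assumes G: "pair_graph G" and free: "\<not> contains_triangle G" "\<not> contains_ISK4 G"
    and max: "maximal_biclique G A B" and V: "pverts G \<noteq> A \<union> B"
  obtains S T where "pverts G = S \<union> T" "S \<noteq> pverts G" "T \<noteq> pverts G"
    "\<And>x y. \<lbrakk>x \<in> S \<inter> T; y \<in> S \<inter> T; x \<noteq> y\<rbrakk> \<Longrightarrow> (x, y) \<in> parcs G"
    "\<And>x y. \<lbrakk>x \<in> S - T; y \<in> T - S\<rbrakk> \<Longrightarrow> (x, y) \<notin> parcs G"
proof -
  let ?adj = "\<lambda>u v. (u, v) \<in> parcs G"
  have E: "parcs G \<subseteq> pverts G \<times> pverts G" "sym (parcs G)"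
    using G by (auto simp: pair_graph_iff)
  have AB: "A \<subseteq> pverts G" "B \<subseteq> pverts G" "3 \<le> card A"
    "\<And>a b. a \<in> A \<Longrightarrow> b \<in> B \<Longrightarrow> (a, b) \<in> parcs G"
    using max unfolding maximal_biclique_def by auto
  define X where "X = pverts G - (A \<union> B)"
  define R where "R = parcs G \<inter> X \<times> X"
  obtain v where v: "v \<in> X" using V AB by (auto simp: X_def)
  define C where "C = R\<^sup>* `` {v}"
  have CX: "C \<subseteq> X"
  proof
    fix c assume "c \<in> C"
    then have "(v, c) \<in> R\<^sup>*" by (simp add: C_def)
    then show "c \<in> X" using v by (induction rule: rtrancl_induct) (auto simp: R_def)
  qed
  have symR: "sym (R\<^sup>*)" using E(2) by (intro sym_rtrancl) (auto simp: R_def sym_def)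
  \<comment> \<open>Connecting \<open>c\<close> to \<open>d\<close> inside \<open>C\<close> would
    otherwise give an attached path from \<open>x\<close> to \<open>y\<close>.\<close>
  have attach: "x = y" if "{x, y} \<subseteq> A \<or> {x, y} \<subseteq> B" "c \<in> C" "d \<in> C" "(x, c) \<in> parcs G" "(d, y) \<in> parcs G"
    for x y c d
  proof (rule ccontr)
    assume "x \<noteq> y"
    have "(c, d) \<in> R\<^sup>*" using that(2,3) symR unfolding C_def by (meson Image_singleton_iff rtrancl_trans symD)
    then obtain ps where ps: "ps \<noteq> []" "hd ps = c" "last ps = d" "set ps \<subseteq> R\<^sup>* `` {c}"
      "successively (\<lambda>u v. (u, v) \<in> R) ps"
      by (rule rtrancl_successively)
    have "R\<^sup>* `` {c} \<subseteq> C" using that(2) by (auto simp: C_def)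
    then have "set ps \<subseteq> pverts G - (A \<union> B)" using ps(4) CX by (auto simp: X_def)
    moreover have "successively ?adj ps" using ps(5) by (rule successively_mono) (auto simp: R_def)
    ultimately have "attached_path G A B x ps y"
      using ps(1-3) that \<open>x \<noteq> y\<close>
      by (auto simp: attached_path_def successively_append_iff successively_Cons)
    then show False using no_attached_path[OF G free max] by blast
  qed
  define K where "K = {h \<in> A \<union> B. \<exists>c\<in>C. (c, h) \<in> parcs G}"
  have KA: "x = y" if "x \<in> K" "y \<in> K" "{x, y} \<subseteq> A \<or> {x, y} \<subseteq> B" for x y
  proof -
    obtain c d where "c \<in> C" "(c, x) \<in> parcs G" "d \<in> C" "(d, y) \<in> parcs G"
      using \<open>x \<in> K\<close> \<open>y \<in> K\<close> by (auto simp: K_def)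
    then show ?thesis using attach[OF that(3), of c d] E(2) by (auto dest: symD)
  qed
  show thesis
  proof (rule that[of "pverts G - C" "C \<union> K"])
    have CV: "C \<subseteq> pverts G" "K \<subseteq> pverts G" "C \<inter> K = {}" "v \<in> C"
      using CX AB by (auto simp: X_def K_def C_def)
    then show "pverts G = pverts G - C \<union> (C \<union> K)" "pverts G - C \<noteq> pverts G" by auto
    \<comment> \<open>Equality would put all of \<open>A\<close> into \<open>K\<close>, which has at
      most one vertex there.\<close>
    show "C \<union> K \<noteq> pverts G"
    proof
      assume "C \<union> K = pverts G"
      then have "A \<subseteq> K" using AB(1) CX by (auto simp: X_def)
      then have "\<forall>x\<in>A. \<forall>y\<in>A. x = y" using KA by blast
      then have "card A \<le> Suc 0"
        using AB(3) card_le_Suc0_iff_eq[of A] card.infinite[of A] by fastforce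
      then show False using AB(3) by simp
    qed
    fix x y
    {
      assume "x \<in> (pverts G - C) \<inter> (C \<union> K)" "y \<in> (pverts G - C) \<inter> (C \<union> K)" "x \<noteq> y"
      then have "x \<in> K" "y \<in> K" "x \<noteq> y" by auto
      then have "x \<in> A \<and> y \<in> B \<or> x \<in> B \<and> y \<in> A" using KA[of x y] by (auto simp: K_def)
      then show "(x, y) \<in> parcs G" using AB(4) E(2) by (auto dest: symD)
    }
    assume xy: "x \<in> pverts G - C - (C \<union> K)" "y \<in> C \<union> K - (pverts G - C)"
    show "(x, y) \<notin> parcs G"
    proof
      assume "(x, y) \<in> parcs G"
      then have yx: "(y, x) \<in> parcs G" using E(2) by (rule symD[rotated])
      have y: "y \<in> C" using xy CV by auto
      \<comment> \<open>A neighbour of \<open>C\<close> in \<open>A \<union> B\<close> would belong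
        to \<open>K\<close>.\<close>
      have "x \<in> X" using xy yx y by (auto simp: X_def K_def)
      then have "(y, x) \<in> R" using yx y CX by (auto simp: R_def)
      then have "x \<in> C" using y by (auto simp: C_def)
      then show False using xy by simp
    qed
  qed
qed

section \<open>Induction on the number of vertices\<close>

text \<open>Hypothesis and conclusion share one vertex type here, so the degree assumption applies
  directly to the induced subgraphs met in the induction.\<close>

lemma triangle_ISK4_free_colorable:
  assumes deg2: "\<And>G :: 'a pair_pre_digraph. \<lbrakk>pair_graph G; pverts G \<noteq> {};
      \<not> contains_triangle G; \<not> contains_ISK4 G; \<not> contains_K33 G\<rbrakk>
      \<Longrightarrow> \<exists>v \<in> pverts G. degree G v \<le> 2"
    and "pair_graph G" "\<not> contains_triangle G" "\<not> contains_ISK4 (G :: 'a pair_pre_digraph)"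
  shows "colorable 3 G"
  using assms(2-)
proof (induction "card (pverts G)" arbitrary: G rule: less_induct)
  case less
  note G = \<open>pair_graph G\<close>
  have fin: "finite (pverts G)" using G by (simp add: pair_graph_iff)
  have IH: "colorable 3 (induced G S)" if "S \<subset> pverts G" for S
    using that fin less.prems pair_graph_induced[OF G, of S]
      contains_triangle_induced[OF G, of S] contains_ISK4_induced[OF G, of S]
    by (intro less.hyps) (auto intro: psubset_card_mono)
  consider "pverts G = {}" | "pverts G \<noteq> {}" "\<not> contains_K33 G" | "contains_K33 G" by blast
  then show ?case
  proof cases
    case 1
    then have "parcs G = {}" using G by (auto simp: pair_graph_iff)
    with 1 show ?thesis by (simp add: colorable_def)
  next
    case 2
    then obtain v where "v \<in> pverts G" "degree G v \<le> 2"
      using deg2 less.prems by blast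
    then show ?thesis by (intro colorable_remove_vertex[OF G, of v] IH) auto
  next
    case 3
    then obtain A B where max: "maximal_biclique G A B" using ex_maximal_biclique[OF G] by blast
    show ?thesis
    proof (cases "pverts G = A \<union> B")
      case True
      then show ?thesis using colorable_biclique[OF G less.prems(2) max] by simp
    next
      case False
      obtain S T where ST: "pverts G = S \<union> T" "S \<noteq> pverts G" "T \<noteq> pverts G"
        "\<And>x y. \<lbrakk>x \<in> S \<inter> T; y \<in> S \<inter> T; x \<noteq> y\<rbrakk> \<Longrightarrow> (x, y) \<in> parcs G"
        "\<And>x y. \<lbrakk>x \<in> S - T; y \<in> T - S\<rbrakk> \<Longrightarrow> (x, y) \<notin> parcs G"
        using biclique_clique_cutset[OF G less.prems(2,3) max False] by blast
      then have "S \<subset> pverts G" "T \<subset> pverts G" by auto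
      then have "colorable 3 (induced G S)" "colorable 3 (induced G T)" using IH by auto
      with G ST(1,4,5) show ?thesis by (rule colorable_clique_cutset)
    qed
  qed
qed

theorem theorem2p7:
  assumes "\<forall>G :: nat pair_pre_digraph.
      pair_graph G \<and> pverts G \<noteq> {} \<and>
      \<not> contains_triangle G \<and> \<not> contains_ISK4 G \<and> \<not> contains_K33 G
      \<longrightarrow> (\<exists>v \<in> pverts G. degree G v \<le> 2)"
  shows "\<forall>G :: 'a pair_pre_digraph.
      pair_graph G \<and> \<not> contains_triangle G \<and> \<not> contains_ISK4 G
      \<longrightarrow> colorable 3 G"
proof (intro allI impI, elim conjE)
  fix G :: "'a pair_pre_digraph"
  assume G: "pair_graph G" and free: "\<not> contains_triangle G" "\<not> contains_ISK4 G"
  have wf: "parcs G \<subseteq> pverts G \<times> pverts G" "finite (pverts G)"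
    using G by (auto simp: pair_graph_iff)
  obtain f :: "'a \<Rightarrow> nat" where f: "inj_on f (pverts G)"
    using finite_imp_inj_to_nat_seg[OF wf(2)] by blast
  \<comment> \<open>The inverse relabelling carries a triangle or ISK4 of the copy on
    \<open>nat\<close> back to \<open>G\<close>, so the copy inherits freeness from
    \<open>G\<close>.\<close>
  define g where "g = inv_into (pverts G) f"
  have inv: "map_graph g (map_graph f G) = G"
    using f by (intro map_graph_inverse[OF wf(1)]) (simp add: g_def)
  have g: "inj_on g (pverts (map_graph f G))"
    by (simp add: g_def inj_on_inv_into)
  have G': "pair_graph (map_graph f G)" using G f by (rule pair_graph_map_graph)
  have "colorable 3 (map_graph f G)"
  proof (rule triangle_ISK4_free_colorable[OF _ G'])
    show "\<not> contains_triangle (map_graph f G)"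
      using contains_triangle_map_graph[OF G' g] free(1) unfolding inv by blast
    show "\<not> contains_ISK4 (map_graph f G)"
      using contains_ISK4_map_graph[OF G' g] free(2) unfolding inv by blast
  qed (use assms in blast)
  then show "colorable 3 G" by (rule colorable_map_graphD)
qed

end
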